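(* Let $U\subset\mathbb{R}^d$ be bounded and open, $T>0$, $\Omega=U\times(0,T]$, and let $\Gamma(\Omega)=(\overline U\times\{0\})\cup(\partial U\times(0,T])$ be its parabolic boundary. Let $P$ be a polynomial, let $u,v\in\mathcal{C}^{2,1}(\Omega)$, and let $a_0>0$ be a constant such that $P(u(x,t))\ge a_0$ for all $(x,t)\in\Omega$. If $$Lv:=\frac{\partial v}{\partial t}-P(u)\Delta v\ge0\quad\text{in }\Omega,$$ then $v(x,t)\ge\min_{\Gamma(\Omega)}v$ for all $(x,t)\in\Omega$.
   Context: $\mathcal{C}^{2,1}(\Omega)$ is the class of functions continuous on $\overline\Omega$ that have two continuous derivatives in $x$ and one continuous derivative in $t$ in $\Omega$ (at $t=T$ the time derivative is the one-sided derivative from below). $\Delta$ is the Laplacian in $x\in\mathbb{R}^d$. *)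

theory Defs
  imports "HOL-Analysis.Analysis" "HOL-Computational_Algebra.Polynomial"
begin

definition parabolic_cylinder :: "(real^'d) set \<Rightarrow> real \<Rightarrow> ((real^'d) \<times> real) set" where
  "parabolic_cylinder U T = U \<times> {0<..T}"

definition parabolic_boundary :: "(real^'d) set \<Rightarrow> real \<Rightarrow> ((real^'d) \<times> real) set" where
  "parabolic_boundary U T = closure U \<times> {0} \<union> frontier U \<times> {0<..T}"

definition space_deriv :: "'d \<Rightarrow> ((real^'d) \<times> real \<Rightarrow> real) \<Rightarrow> (real^'d) \<times> real \<Rightarrow> real" where
  "space_deriv i f = (\<lambda>(x, t). deriv (\<lambda>h. f (x + h *\<^sub>R axis i 1, t)) 0)"

definition space_differentiable :: "'d \<Rightarrow> ((real^'d) \<times> real \<Rightarrow> real) \<Rightarrow> (real^'d) \<times> real \<Rightarrow> bool" where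
  "space_differentiable i f = (\<lambda>(x, t). (\<lambda>h. f (x + h *\<^sub>R axis i 1, t)) differentiable (at 0))"

text \<open>Relative to \<open>{0<..T}\<close> the time derivative is the ordinary two-sided one for
  \<open>0 < t < T\<close> and the derivative from below at \<open>t = T\<close>.\<close>

definition time_deriv :: "real \<Rightarrow> ((real^'d) \<times> real \<Rightarrow> real) \<Rightarrow> (real^'d) \<times> real \<Rightarrow> real" where
  "time_deriv T f = (\<lambda>(x, t). vector_derivative (\<lambda>s. f (x, s)) (at t within {0<..T}))"

definition time_differentiable :: "real \<Rightarrow> ((real^'d) \<times> real \<Rightarrow> real) \<Rightarrow> (real^'d) \<times> real \<Rightarrow> bool" where
  "time_differentiable T f = (\<lambda>(x, t). (\<lambda>s. f (x, s)) differentiable (at t within {0<..T}))"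

definition laplacian :: "((real^'d) \<times> real \<Rightarrow> real) \<Rightarrow> (real^'d) \<times> real \<Rightarrow> real" where
  "laplacian f p = (\<Sum>i\<in>UNIV. space_deriv i (space_deriv i f) p)"

definition C21 :: "(real^'d) set \<Rightarrow> real \<Rightarrow> ((real^'d) \<times> real \<Rightarrow> real) set" where
  "C21 U T = {f.
     continuous_on (closure (parabolic_cylinder U T)) f \<and>
     (\<forall>i. (\<forall>p\<in>parabolic_cylinder U T. space_differentiable i f p) \<and>
          continuous_on (parabolic_cylinder U T) (space_deriv i f)) \<and>
     (\<forall>i j. (\<forall>p\<in>parabolic_cylinder U T. space_differentiable j (space_deriv i f) p) \<and>
            continuous_on (parabolic_cylinder U T) (space_deriv j (space_deriv i f))) \<and>
     (\<forall>p\<in>parabolic_cylinder U T. time_differentiable T f p) \<and>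
     continuous_on (parabolic_cylinder U T) (time_deriv T f)}"

end

theory Submission
  imports Defs
begin

text \<open>If \<open>v\<close> were below its minimum over the parabolic boundary at some point, then so would be
  \<open>v + \<epsilon> t\<close> for a small \<open>\<epsilon> > 0\<close>, and this function would attain its minimum over the closed
  cylinder at a point of \<open>U \<times> (0,T]\<close>. There \<open>\<Delta>v \<ge> 0\<close> and \<open>\<partial>v/\<partial>t \<le> -\<epsilon>\<close>, so \<open>Lv < 0\<close>.\<close>

text \<open>If \<open>l\<close> were negative, \<open>g'\<close> would drop below
  \<open>g' a = 0\<close> just to the right of \<open>a\<close>, and the mean value theorem would
  put \<open>g\<close> below \<open>g a\<close> there. This asks for a second derivative at
  \<open>a\<close> alone.\<close>

lemma second_derivative_nonneg_at_local_min:
  fixes g g' :: "real \<Rightarrow> real"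
  assumes "d > 0"
    and g: "\<And>x. \<bar>x - a\<bar> < d \<Longrightarrow> (g has_real_derivative g' x) (at x)"
    and min: "\<And>x. \<bar>x - a\<bar> < d \<Longrightarrow> g a \<le> g x"
    and g': "(g' has_real_derivative l) (at a)"
  shows "l \<ge> 0"
proof (rule ccontr)
  assume "\<not> l \<ge> 0"
  then obtain e where e: "e > 0" "\<And>h. h > 0 \<Longrightarrow> h < e \<Longrightarrow> g' (a + h) < g' a"
    using DERIV_neg_dec_right[OF g'] by force
  have "g' a = 0"
    using DERIV_local_min[OF g[of a] \<open>d > 0\<close>] min \<open>d > 0\<close> by (simp add: abs_minus_commute)
  define h where "h = min d e / 2"
  have h: "h > 0" "h < d" "h < e"
    using \<open>d > 0\<close> \<open>e > 0\<close> by (auto simp: h_def)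
  obtain z where z: "a < z" "z < a + h" "g (a + h) - g a = (a + h - a) * g' z"
    using MVT2[of a "a + h" g g'] h g by force
  have "g' z < 0"
    using e(2)[of "z - a"] z h \<open>g' a = 0\<close> by simp
  then have "g (a + h) < g a"
    using z(3) h(1) mult_pos_neg[of h "g' z"] by simp
  with min[of "a + h"] h show False by simp
qed

text \<open>Turns iterated partial derivatives into iterated derivatives of a one-variable slice, to
  which the second derivative test applies.\<close>

lemma space_deriv_along_axis:
  "space_deriv i f (x + h *\<^sub>R axis i 1, t) = deriv (\<lambda>k. f (x + k *\<^sub>R axis i 1, t)) h"
  using DERIV_shift[of "\<lambda>k. f (x + k *\<^sub>R axis i 1, t)" _ 0 h]
  by (simp add: space_deriv_def deriv_def algebra_simps)

text \<open>Each summand is the second derivative at 0 of the slice of \<open>f\<close> through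
  \<open>x\<close> along one axis, and that slice has a local minimum at 0.\<close>

lemma laplacian_nonneg_at_min:
  fixes x :: "real^'d"
  assumes "open U" and "x \<in> U"
    and f: "\<And>i y. y \<in> U \<Longrightarrow> space_differentiable i f (y, t)"
    and f': "\<And>i. space_differentiable i (space_deriv i f) (x, t)"
    and min: "\<And>y. y \<in> U \<Longrightarrow> f (x, t) \<le> f (y, t)"
  shows "laplacian f (x, t) \<ge> 0"
  unfolding laplacian_def
proof (rule sum_nonneg)
  fix i :: 'd
  obtain d where "d > 0" and d: "ball x d \<subseteq> U"
    using assms(1,2) openE by blast
  define g where "g k = f (x + k *\<^sub>R axis i 1, t)" for k
  have mem: "x + h *\<^sub>R axis i 1 \<in> U" if "\<bar>h\<bar> < d" for h
    using that d by (auto simp: subset_iff dist_norm norm_axis_1)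
  have g: "(g has_real_derivative deriv g h) (at h)" if "\<bar>h - 0\<bar> < d" for h
  proof -
    \<comment> \<open>\<open>space_differentiable\<close> always differentiates at parameter 0, so
      differentiability of \<open>g\<close> at \<open>h\<close> comes from moving the base point to
      \<open>x + h *\<^sub>R axis i 1\<close>.\<close>
    have "(\<lambda>k. g (k + h)) differentiable (at 0)"
      using f[OF mem, of h i] that
      by (simp add: space_differentiable_def g_def algebra_simps)
    then obtain D where "((\<lambda>k. g (k + h)) has_real_derivative D) (at 0)"
      by (auto simp: real_differentiable_def)
    then have "(g has_real_derivative D) (at h)"
      using DERIV_shift[of g D 0 h] by simp
    then show ?thesis
      using DERIV_imp_deriv by blast
  qed
  have "(deriv g has_real_derivative deriv (deriv g) 0) (at 0)"
    using f'[of i]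
    by (auto simp: space_differentiable_def space_deriv_along_axis g_def[abs_def]
        real_differentiable_def DERIV_imp_deriv)
  moreover have "g 0 \<le> g h" if "\<bar>h - 0\<bar> < d" for h
    using min[OF mem, of h] that by (simp add: g_def)
  ultimately have "deriv (deriv g) 0 \<ge> 0"
    using second_derivative_nonneg_at_local_min[OF \<open>d > 0\<close> g] by blast
  then show "space_deriv i (space_deriv i f) (x, t) \<ge> 0"
    using space_deriv_along_axis[of i "space_deriv i f" x 0 t]
    by (simp add: space_deriv_along_axis g_def[abs_def])
qed

text \<open>If the derivative of \<open>f (x, s) + c * s\<close> at \<open>t\<close> were positive,
  slightly earlier times would give smaller values. Only times up to \<open>t\<close> are compared,
  so the case \<open>t = T\<close> is covered too.\<close>

lemma time_deriv_nonpos_at_past_min: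
  assumes f: "time_differentiable T f (x, t)" and t: "0 < t" "t \<le> T"
    and min: "\<And>s. 0 < s \<Longrightarrow> s \<le> t \<Longrightarrow> f (x, t) + c * t \<le> f (x, s) + c * s"
  shows "time_deriv T f (x, t) \<le> - c"
proof (rule ccontr)
  assume neg: "\<not> ?thesis"
  have "((\<lambda>s. f (x, s)) has_real_derivative time_deriv T f (x, t)) (at t within {0<..T})"
    using f by (simp add: time_differentiable_def time_deriv_def vector_derivative_works
        has_real_derivative_iff_has_vector_derivative)
  then have "((\<lambda>s. f (x, s) + c * s) has_real_derivative time_deriv T f (x, t) + c)
      (at t within {0<..T})"
    by (auto intro!: derivative_eq_intros)
  from has_real_derivative_pos_inc_left[OF this] neg
  obtain d where "d > 0" and
    d: "\<And>h. h > 0 \<Longrightarrow> t - h \<in> {0<..T} \<Longrightarrow> h < d \<Longrightarrow> f (x, t - h) + c * (t - h) < f (x, t) + c * t"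
    by auto
  \<comment> \<open>Staying below \<open>t\<close> keeps \<open>t - h\<close> positive, inside the
    interval where the minimum is assumed.\<close>
  define h where "h = min d t / 2"
  have "h > 0" "h < d" "h < t"
    using \<open>d > 0\<close> t by (auto simp: h_def)
  with d[of h] min[of "t - h"] t show False by simp
qed

lemma closure_parabolic_cylinder:
  assumes "T > 0"
  shows "closure (parabolic_cylinder U T) = closure U \<times> {0..T}"
  using assms by (simp add: parabolic_cylinder_def closure_Times)

text \<open>The added set \<open>frontier U \<times> {0}\<close> already lies in the bottom
  \<open>closure U \<times> {0}\<close>. In this form the boundary of a bounded \<open>U\<close> is
  visibly a union of products of compact sets.\<close>

lemma parabolic_boundary_eq:
  assumes "T > 0"
  shows "parabolic_boundary U T = closure U \<times> {0} \<union> frontier U \<times> {0..T}"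
  using assms by (auto simp: parabolic_boundary_def frontier_def)

lemma closure_parabolic_cylinder_decomp:
  assumes "open U" and "T > 0"
  shows "closure (parabolic_cylinder U T) = parabolic_cylinder U T \<union> parabolic_boundary U T"
  unfolding closure_parabolic_cylinder[OF \<open>T > 0\<close>]
  using assms closure_subset[of U]
  by (auto simp: parabolic_boundary_eq parabolic_cylinder_def frontier_def interior_open)

theorem lemma3:
  fixes U :: "(real^'d) set" and T a0 :: real and P :: "real poly"
    and u v :: "(real^'d) \<times> real \<Rightarrow> real"
  assumes "bounded U" and "open U" and "T > 0"
    and "u \<in> C21 U T" and "v \<in> C21 U T"
    and "a0 > 0"
    and "\<forall>p\<in>parabolic_cylinder U T. poly P (u p) \<ge> a0"
    and "\<forall>p\<in>parabolic_cylinder U T. time_deriv T v p - poly P (u p) * laplacian v p \<ge> 0"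
  shows "\<forall>p\<in>parabolic_cylinder U T. \<exists>q\<in>parabolic_boundary U T.
           (\<forall>r\<in>parabolic_boundary U T. v q \<le> v r) \<and> v p \<ge> v q"
proof
  let ?C = "parabolic_cylinder U T" and ?B = "parabolic_boundary U T"
  fix p assume p: "p \<in> ?C"
  have cont: "continuous_on (closure ?C) v"
    using assms(5) by (simp add: C21_def)
  have decomp: "closure ?C = ?C \<union> ?B"
    using assms(2,3) by (rule closure_parabolic_cylinder_decomp)
  have "compact ?B"
    unfolding parabolic_boundary_eq[OF \<open>T > 0\<close>] using \<open>bounded U\<close>
    by (intro compact_Un compact_Times) (auto simp: compact_closure compact_frontier_bounded)
  moreover have "?B \<noteq> {}"
    using p by (auto simp: parabolic_boundary_def parabolic_cylinder_def)
  ultimately obtain q where q: "q \<in> ?B" "\<And>r. r \<in> ?B \<Longrightarrow> v q \<le> v r"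
    using continuous_attains_inf[of ?B v] continuous_on_subset[OF cont] decomp by blast
  have "v q \<le> v p"
  proof (rule ccontr)
    assume "\<not> v q \<le> v p"
    \<comment> \<open>Up to time \<open>T\<close> the added term is at most half the gap
      \<open>v q - v p\<close>, so the perturbed value at \<open>p\<close> stays below
      \<open>v q\<close>.\<close>
    define \<epsilon> where "\<epsilon> = (v q - v p) / (2 * T)"
    have "\<epsilon> > 0"
      using \<open>\<not> v q \<le> v p\<close> \<open>T > 0\<close> by (simp add: \<epsilon>_def)
    define w where "w r = v r + \<epsilon> * snd r" for r
    have "compact (closure ?C)"
      using \<open>bounded U\<close> closure_parabolic_cylinder[OF \<open>T > 0\<close>, of U]
      by (simp add: compact_Times compact_closure)
    moreover have "continuous_on (closure ?C) w"
      unfolding w_def by (intro continuous_intros cont)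
    ultimately obtain r where r: "r \<in> closure ?C" "\<And>s. s \<in> closure ?C \<Longrightarrow> w r \<le> w s"
      using continuous_attains_inf[of "closure ?C" w] p closure_subset[of ?C] by blast
    have "\<epsilon> * snd p \<le> \<epsilon> * T"
      using p \<open>\<epsilon> > 0\<close> by (auto simp: parabolic_cylinder_def)
    also have "\<dots> = (v q - v p) / 2"
      using \<open>T > 0\<close> by (simp add: \<epsilon>_def)
    finally have "w p < v q"
      using \<open>\<not> v q \<le> v p\<close> by (simp add: w_def)
    moreover have "w r \<le> w p"
      using r(2) p decomp by blast
    \<comment> \<open>The perturbation is nonnegative, so it cannot lower the boundary values; this
      keeps the minimizer \<open>r\<close> off the boundary.\<close>
    moreover have "v q \<le> w s" if "s \<in> ?B" for s
    proof -
      have "snd s \<ge> 0"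
        using that by (auto simp: parabolic_boundary_def)
      then show ?thesis
        using q(2)[OF that] \<open>\<epsilon> > 0\<close> by (simp add: w_def add_increasing2)
    qed
    ultimately have "r \<notin> ?B"
      by (meson le_less_trans not_le)
    then have "r \<in> ?C"
      using r(1) decomp by blast
    then obtain x t where xt: "r = (x, t)" "x \<in> U" "0 < t" "t \<le> T"
      by (auto simp: parabolic_cylinder_def)
    \<comment> \<open>Used twice: \<open>s = t\<close> gives a spatial minimum of \<open>v\<close>,
      and \<open>y = x\<close> gives the minimum over past times.\<close>
    have min: "v (x, t) + \<epsilon> * t \<le> v (y, s) + \<epsilon> * s" if "y \<in> U" "0 < s" "s \<le> T" for y s
      using r(2)[of "(y, s)"] that decomp by (simp add: w_def xt(1) parabolic_cylinder_def)
    have "laplacian v (x, t) \<ge> 0"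
    proof (rule laplacian_nonneg_at_min[OF \<open>open U\<close> \<open>x \<in> U\<close>])
      show "space_differentiable i v (y, t)" if "y \<in> U" for i y
        using assms(5) that xt by (simp add: C21_def parabolic_cylinder_def)
      show "space_differentiable i (space_deriv i v) (x, t)" for i
        using assms(5) xt by (simp add: C21_def parabolic_cylinder_def)
      show "v (x, t) \<le> v (y, t)" if "y \<in> U" for y
        using min[OF that, of t] xt by simp
    qed
    moreover have "poly P (u r) \<ge> 0"
      using assms(6,7) \<open>r \<in> ?C\<close> by force
    moreover have "time_deriv T v (x, t) \<le> - \<epsilon>"
    proof (rule time_deriv_nonpos_at_past_min)
      show "time_differentiable T v (x, t)"
        using assms(5) xt by (simp add: C21_def parabolic_cylinder_def)
    qed (use xt min in auto)
    ultimately have "time_deriv T v r - poly P (u r) * laplacian v r < 0"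
      using \<open>\<epsilon> > 0\<close> mult_nonneg_nonneg[of "poly P (u r)" "laplacian v r"]
      unfolding xt(1) by linarith
    with assms(8) \<open>r \<in> ?C\<close> show False by force
  qed
  with q show "\<exists>q\<in>?B. (\<forall>r\<in>?B. v q \<le> v r) \<and> v p \<ge> v q" by blast
qed

end
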